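(* Let $K$ be a noetherian commutative ring with unity. For every $c\in\mathbb{N}$, let $K[X]=K[x_{i,j} : i\in[c],\ j\in\mathbb{N}]$. Then: (i) $K[X]$ is an $\mathrm{Inc}(\mathbb{N})$-noetherian $K$-algebra, that is, every $\mathrm{Inc}(\mathbb{N})$-invariant ideal of $K[X]$ can be generated by finitely many $\mathrm{Inc}(\mathbb{N})$-orbits. (ii) $K[X]$ is a $\mathrm{Sym}(\infty)$-noetherian $K$-algebra, that is, every $\mathrm{Sym}(\infty)$-invariant ideal of $K[X]$ can be generated by finitely many $\mathrm{Sym}(\infty)$-orbits.
   Context: $\mathbb{N}$ is the set of positive integers and $[c]=\{1,\dots,c\}$. $\mathrm{Inc}(\mathbb{N})=\{\pi\colon\mathbb{N}\to\mathbb{N} : \pi(i)<\pi(i+1)\text{ for all }i\ge1\}$ is a monoid under composition. $\mathrm{Sym}(\infty)=\bigcup_{n\in\mathbb{N}}\mathrm{Sym}(n)$, where $\mathrm{Sym}(n)$ is embedded into $\mathrm{Sym}(n+1)$ as the stabilizer of $n+1$. Both act on $K[X]$ by $K$-algebra endomorphisms determined by $\pi\cdot x_{i,j}=x_{i,\pi(j)}$. An ideal $I$ is $\Pi$-invariant if $\pi\cdot f\in I$ for all $\pi\in\Pi$, $f\in I$. *)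

theory Defs
  imports
    "HOL-Algebra.Ring_Divisibility"
    "HOL-Library.Poly_Mapping"
    "HOL-Combinatorics.Permutations"
begin

text \<open>
  A monomial in the variables \<open>x\<^sub>i\<^sub>j\<close> is a finitely supported exponent vector on pairs
  \<open>(i, j)\<close>, and a polynomial is a finitely supported family of coefficients on monomials;
  \<^theory>\<open>HOL-Library.Poly_Mapping\<close> supplies the ring operations.
\<close>

type_synonym 'k xpoly = "((nat \<times> nat) \<Rightarrow>\<^sub>0 nat) \<Rightarrow>\<^sub>0 'k"

text \<open>
  A commutative ring with unity is a type of sort \<open>{comm_ring, comm_monoid_mult}\<close>. Unlike
  \<^class>\<open>comm_ring_1\<close>, this does not exclude the zero ring.
\<close>

definition coeff_ring :: "'k::{comm_ring, comm_monoid_mult} ring" where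
  "coeff_ring = \<lparr>carrier = UNIV, monoid.mult = (*), one = 1, zero = 0, add = (+)\<rparr>"

text \<open>
  \<open>K[x\<^sub>i\<^sub>j : i \<in> [c], j \<ge> 1]\<close>. The unit is spelled out as the constant polynomial because the
  type class instance of \<open>1\<close> for \<^typ>\<open>'k xpoly\<close> needs \<open>0 \<noteq> 1\<close> in \<open>'k\<close>.
\<close>

definition poly_ring_X :: "nat \<Rightarrow> 'k::{comm_ring, comm_monoid_mult} xpoly ring" where
  "poly_ring_X c =
    \<lparr>carrier = {p. \<forall>m \<in> Poly_Mapping.keys p. Poly_Mapping.keys m \<subseteq> {1..c} \<times> {1..}},
     monoid.mult = (*), one = Poly_Mapping.single 0 1, zero = 0, add = (+)\<rparr>"

definition const_X :: "'k \<Rightarrow> 'k::{comm_ring, comm_monoid_mult} xpoly" where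
  "const_X a = Poly_Mapping.single 0 a"

definition var_X :: "nat \<Rightarrow> nat \<Rightarrow> 'k::{comm_ring, comm_monoid_mult} xpoly" where
  "var_X i j = Poly_Mapping.single (Poly_Mapping.single (i, j) 1) 1"

text \<open>
  Relabelling of keys, where values over the same new key add up. Applied to \<open>(i, j) \<mapsto> (i, \<pi> j)\<close>
  it acts on monomials, and applied once more it acts on polynomials; the lemmas below show that
  the result is the \<open>K\<close>-algebra endomorphism with \<open>x\<^sub>i\<^sub>j \<mapsto> x\<^sub>i\<^sub>\<pi>\<^sub>(\<^sub>j\<^sub>)\<close>.
\<close>

definition relabel :: "('a \<Rightarrow> 'b) \<Rightarrow> ('a \<Rightarrow>\<^sub>0 'c::comm_monoid_add) \<Rightarrow> ('b \<Rightarrow>\<^sub>0 'c)" where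
  "relabel f p = (\<Sum>k \<in> Poly_Mapping.keys p. Poly_Mapping.single (f k) (Poly_Mapping.lookup p k))"

definition act_X :: "(nat \<Rightarrow> nat) \<Rightarrow> 'k::{comm_ring, comm_monoid_mult} xpoly \<Rightarrow> 'k xpoly" where
  "act_X \<pi> = relabel (relabel (\<lambda>(i, j). (i, \<pi> j)))"

text \<open>
  The positive integers are the positive elements of \<^typ>\<open>nat\<close>. Self-maps of them are represented
  by functions fixing the unused argument \<open>0\<close>, so that each such map has exactly one representative
  and composition is \<^const>\<open>comp\<close>.
\<close>

definition Inc_N :: "(nat \<Rightarrow> nat) set" where
  "Inc_N = {\<pi>. \<pi> 0 = 0 \<and> (\<forall>i\<ge>1. \<pi> i \<ge> 1 \<and> \<pi> i < \<pi> (i + 1))}"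

definition Sym_inf :: "(nat \<Rightarrow> nat) set" where
  "Sym_inf = (\<Union>n\<in>{1..}. {\<pi>. \<pi> permutes {1..n}})"

definition orbit_of :: "('g \<Rightarrow> 'r \<Rightarrow> 'r) \<Rightarrow> 'g set \<Rightarrow> 'r \<Rightarrow> 'r set" where
  "orbit_of act G f = (\<lambda>g. act g f) ` G"

definition invariant_ideal :: "('g \<Rightarrow> 'r \<Rightarrow> 'r) \<Rightarrow> 'g set \<Rightarrow> ('r, 'm) ring_scheme \<Rightarrow> 'r set \<Rightarrow> bool" where
  "invariant_ideal act G R I \<longleftrightarrow> ideal I R \<and> (\<forall>g\<in>G. \<forall>f\<in>I. act g f \<in> I)"

definition equivariantly_noetherian ::
    "('g \<Rightarrow> 'r \<Rightarrow> 'r) \<Rightarrow> 'g set \<Rightarrow> ('r, 'm) ring_scheme \<Rightarrow> bool" where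
  "equivariantly_noetherian act G R \<longleftrightarrow>
    (\<forall>I. invariant_ideal act G R I \<longrightarrow>
      (\<exists>F \<subseteq> carrier R. finite F \<and> I = genideal R (\<Union>f\<in>F. orbit_of act G f)))"


lemma relabel_superset:
  assumes "finite A" "Poly_Mapping.keys p \<subseteq> A"
  shows "relabel f p = (\<Sum>k\<in>A. Poly_Mapping.single (f k) (Poly_Mapping.lookup p k))"
  unfolding relabel_def
  by (rule sum.mono_neutral_left) (use assms in \<open>auto simp: in_keys_iff\<close>)

lemma relabel_zero [simp]: "relabel f 0 = 0"
  by (simp add: relabel_def)

lemma relabel_single [simp]:
  "relabel f (Poly_Mapping.single k a) = Poly_Mapping.single (f k) a"
  by (simp add: relabel_def)

lemma relabel_add: "relabel f (p + q) = relabel f p + relabel f q"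
proof -
  let ?A = "Poly_Mapping.keys p \<union> Poly_Mapping.keys q"
  have "Poly_Mapping.keys (p + q) \<subseteq> ?A"
    by (rule Poly_Mapping.keys_add)
  then show ?thesis
    by (simp add: relabel_superset[of ?A] lookup_add single_add sum.distrib)
qed

lemma keys_relabel: "Poly_Mapping.keys (relabel f p) \<subseteq> f ` Poly_Mapping.keys p"
  unfolding relabel_def by (rule order_trans[OF keys_sum]) (auto split: if_splits)

lemma update_conv_add:
  "k \<notin> Poly_Mapping.keys p \<Longrightarrow> Poly_Mapping.update k a p = p + Poly_Mapping.single k a"
  by (intro poly_mapping_eqI) (auto simp: lookup_update lookup_add lookup_single in_keys_iff when_def)

lemma relabel_mult:
  fixes p q :: "'a::comm_monoid_add \<Rightarrow>\<^sub>0 'c::comm_ring"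
  assumes "\<And>a b. f (a + b) = f a + (f b :: 'b::comm_monoid_add)"
  shows "relabel f (p * q) = relabel f p * relabel f q"
proof (induction p rule: update_induct)
  case const
  then show ?case by simp
next
  case (update p k a)
  have single_mult: "relabel f (Poly_Mapping.single k a * q)
      = Poly_Mapping.single (f k) a * relabel f q" for q
  proof (induction q rule: update_induct)
    case const
    then show ?case by simp
  next
    case (update q l b)
    have "Poly_Mapping.update l b q = q + Poly_Mapping.single l b"
      using update(1) by (rule update_conv_add)
    then show ?case
      using update by (simp add: distrib_left relabel_add mult_single assms)
  qed
  have "Poly_Mapping.update k a p = p + Poly_Mapping.single k a"
    using update(1) by (rule update_conv_add)
  then show ?case
    using update by (simp add: distrib_right relabel_add single_mult)
qed

lemma act_X_add: "act_X \<pi> (p + q) = act_X \<pi> p + act_X \<pi> q"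
  by (simp add: act_X_def relabel_add)

lemma act_X_mult: "act_X \<pi> (p * q) = act_X \<pi> p * act_X \<pi> q"
  unfolding act_X_def by (rule relabel_mult) (rule relabel_add)

lemma act_X_const: "act_X \<pi> (const_X a) = const_X a"
  by (simp add: act_X_def const_X_def)

lemma act_X_var: "act_X \<pi> (var_X i j) = var_X i (\<pi> j)"
  by (simp add: act_X_def var_X_def)

lemma cring_coeff_ring: "cring coeff_ring"
  unfolding coeff_ring_def
  by unfold_locales (auto simp: Units_def algebra_simps intro: exI[of _ "- x" for x] add.right_inverse)

lemma carrier_poly_ring_X_mult:
  assumes "p \<in> carrier (poly_ring_X c)" "q \<in> carrier (poly_ring_X c)"
  shows "p * q \<in> carrier (poly_ring_X c)"
proof -
  have "Poly_Mapping.keys m \<subseteq> {1..c} \<times> {1..}" if "m \<in> Poly_Mapping.keys (p * q)" for m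
  proof -
    from that obtain a b where "m = a + b" "a \<in> Poly_Mapping.keys p" "b \<in> Poly_Mapping.keys q"
      using keys_mult[of p q] by blast
    then show ?thesis
      using assms Poly_Mapping.keys_add[of a b] unfolding poly_ring_X_def by fastforce
  qed
  then show ?thesis by (simp add: poly_ring_X_def)
qed

lemma cring_poly_ring_X:
  "cring (poly_ring_X c :: 'k::{comm_ring, comm_monoid_mult} xpoly ring)"
proof -
  let ?R = "poly_ring_X c :: 'k xpoly ring"
  have one: "Poly_Mapping.single 0 1 * p = p" for p :: "'k xpoly"
  proof (induction p rule: update_induct)
    case (update p k a)
    have "Poly_Mapping.update k a p = p + Poly_Mapping.single k a"
      using update(1) by (rule update_conv_add)
    then show ?case
      using update by (simp add: distrib_left mult_single)
  qed simp
  then have one': "p * Poly_Mapping.single 0 1 = p" for p :: "'k xpoly"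
    by (simp add: mult.commute)
  show ?thesis
  proof (rule cringI)
    show "abelian_group ?R"
    proof (rule abelian_groupI)
      fix p q assume "p \<in> carrier ?R" "q \<in> carrier ?R"
      then show "p \<oplus>\<^bsub>?R\<^esub> q \<in> carrier ?R"
        using Poly_Mapping.keys_add[of p q] by (fastforce simp: poly_ring_X_def)
    next
      fix p assume "p \<in> carrier ?R"
      then show "\<exists>q \<in> carrier ?R. q \<oplus>\<^bsub>?R\<^esub> p = \<zero>\<^bsub>?R\<^esub>"
        by (intro bexI[of _ "- p"]) (auto simp: poly_ring_X_def)
    qed (auto simp: poly_ring_X_def algebra_simps)
    show "comm_monoid ?R"
    proof (rule comm_monoidI)
      fix p q assume "p \<in> carrier ?R" "q \<in> carrier ?R"
      then show "p \<otimes>\<^bsub>?R\<^esub> q \<in> carrier ?R"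
        using carrier_poly_ring_X_mult[of p c q] by (simp add: poly_ring_X_def)
    qed (auto simp: poly_ring_X_def one one' ac_simps)
  qed (auto simp: poly_ring_X_def algebra_simps)
qed

lemma act_X_endomorphism:
  assumes "\<pi> \<in> Inc_N \<union> Sym_inf"
  shows "act_X \<pi> \<in> ring_hom (poly_ring_X c) (poly_ring_X c)"
proof (rule ring_hom_memI)
  have pos: "\<pi> j \<ge> 1" if "j \<ge> 1" for j
    using assms that permutes_in_image[of \<pi> "{1.._}" j] permutes_not_in[of \<pi> "{1.._}" j]
    by (auto simp: Inc_N_def Sym_inf_def) metis
  fix p :: "'k::{comm_ring, comm_monoid_mult} xpoly" assume p: "p \<in> carrier (poly_ring_X c)"
  have "Poly_Mapping.keys (relabel (\<lambda>(i, j). (i, \<pi> j)) m) \<subseteq> {1..c} \<times> {1..}"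
    if "m \<in> Poly_Mapping.keys p" for m
  proof -
    have "Poly_Mapping.keys m \<subseteq> {1..c} \<times> {1..}"
      using p that by (auto simp: poly_ring_X_def)
    then have "(\<lambda>(i, j). (i, \<pi> j)) ` Poly_Mapping.keys m \<subseteq> {1..c} \<times> {1..}"
      using pos by fastforce
    then show ?thesis by (rule order_trans[OF keys_relabel])
  qed
  moreover have "Poly_Mapping.keys (act_X \<pi> p)
      \<subseteq> relabel (\<lambda>(i, j). (i, \<pi> j)) ` Poly_Mapping.keys p"
    unfolding act_X_def by (rule keys_relabel)
  ultimately have "\<forall>m \<in> Poly_Mapping.keys (act_X \<pi> p). Poly_Mapping.keys m \<subseteq> {1..c} \<times> {1..}"
    unfolding image_def by (intro ballI) (drule subsetD, assumption, elim CollectE bexE, simp only:)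
  then show "act_X \<pi> p \<in> carrier (poly_ring_X c)"
    by (simp add: poly_ring_X_def)
qed (simp_all add: poly_ring_X_def act_X_add act_X_mult act_X_const[unfolded const_X_def])

end

theory Submission
  imports Defs "HOL-Library.Ramsey" "HOL-Library.Sublist" "HOL-Library.Multiset_Order"
    "HOL-Library.Product_Lexorder"
begin

text \<open>
  The proof is a Groebner basis argument in which divisibility of monomials is replaced by
  divisibility up to \<open>Inc(\<nat>)\<close>: a monomial \<open>m\<close> divides \<open>n\<close> in this sense if some translate
  \<open>\<pi> \<cdot> m\<close>, with \<open>\<pi>\<close> increasing, divides \<open>n\<close>.

  Reading the columns of a monomial from left to right makes it a word over \<open>\<nat>\<^sup>c\<close>, and divisibility
  up to \<open>Inc(\<nat>)\<close> becomes embedding of words with componentwise comparison of letters. By Higman's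
  lemma (\<open>almost_full_list_emb\<close>) every sequence of monomials has an infinite subsequence in which
  each term divides all later ones (\<open>Inc_dvd_subseq\<close>).

  Comparing monomials by the last variable in which they differ is a well-order that is respected
  by multiplication and by increasing maps, so leading terms are compatible with both
  (\<open>colex_mult_shift_less\<close>, \<open>reduction_lowers_lead\<close>).

  Suppose now that an \<open>Inc(\<nat>)\<close>-invariant ideal \<open>I\<close> is not generated by finitely many orbits. Choose
  \<open>f\<^sub>0, f\<^sub>1, \<dots>\<close> such that \<open>f\<^sub>n\<close> has the smallest leading monomial among the elements of \<open>I\<close> outside
  the ideal generated by the orbits of \<open>f\<^sub>0, \<dots>, f\<^sub>n\<^sub>-\<^sub>1\<close>. Along a subsequence the leading monomials
  divide each other, and since \<open>K\<close> is noetherian some leading coefficient is a combination of the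
  earlier ones. The corresponding combination of translates of earlier elements cancels the leading
  term, which leaves an element outside the same ideal with a smaller leading monomial: a
  contradiction. For permutations, it is enough that on any single polynomial an increasing map
  acts like a permutation of finitely many columns, so that a \<open>Sym(\<infinity>)\<close>-invariant ideal is
  \<open>Inc(\<nat>)\<close>-invariant and \<open>Inc(\<nat>)\<close>-orbits lie in \<open>Sym(\<infinity>)\<close>-orbits.
\<close>

section \<open>Almost full relations and Higman's lemma\<close>

definition almost_full :: "('a \<Rightarrow> 'a \<Rightarrow> bool) \<Rightarrow> bool" where
  "almost_full P \<longleftrightarrow> (\<forall>f :: nat \<Rightarrow> 'a. \<exists>i j. i < j \<and> P (f i) (f j))"

text \<open>
  Ramsey's theorem for pairs, where the pair \<open>i < j\<close> is coloured by whether \<open>P (f i) (f j)\<close> holds: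
  on a homogeneous set of the other colour \<open>P\<close> would fail for all pairs, against almost fullness.
\<close>

lemma almost_full_subseq:
  fixes f :: "nat \<Rightarrow> 'a"
  assumes "almost_full P"
  obtains \<phi> :: "nat \<Rightarrow> nat" where "strict_mono \<phi>" "\<And>i j. i < j \<Longrightarrow> P (f (\<phi> i)) (f (\<phi> j))"
proof -
  define col :: "nat set \<Rightarrow> nat" where "col S = (if P (f (Min S)) (f (Max S)) then 1 else 0)" for S
  have "\<exists>Y t. Y \<subseteq> UNIV \<and> infinite Y \<and> t < (2::nat) \<and> (\<forall>x\<in>Y. \<forall>y\<in>Y. x \<noteq> y \<longrightarrow> col {x, y} = t)"
    by (rule Ramsey2) (auto simp: col_def)
  then obtain Y t where Y: "infinite Y" "\<forall>x\<in>Y. \<forall>y\<in>Y. x \<noteq> y \<longrightarrow> col {x, y} = t"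
    by (elim exE conjE)
  define \<phi> where "\<phi> = enumerate Y"
  have \<phi>: "strict_mono \<phi>" "\<And>i. \<phi> i \<in> Y"
    using Y(1) unfolding \<phi>_def by (rule strict_mono_enumerate, rule enumerate_in_set)
  have col: "(if P (f (\<phi> i)) (f (\<phi> j)) then 1 else 0) = t" if "i < j" for i j
  proof -
    have "col {\<phi> i, \<phi> j} = t"
      using Y(2) \<phi>(2) strict_monoD[OF \<phi>(1) that] by (metis less_irrefl)
    then show ?thesis
      using strict_monoD[OF \<phi>(1) that] by (simp add: col_def min_def max_def)
  qed
  obtain i j where "i < j" "P (f (\<phi> i)) (f (\<phi> j))"
    using assms[unfolded almost_full_def, THEN spec, of "\<lambda>i. f (\<phi> i)"] by (elim exE conjE)
  then have "t = 1" using col[of i j] by simp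
  have "P (f (\<phi> i)) (f (\<phi> j))" if "i < j" for i j
    using col[OF that] \<open>t = 1\<close> by (metis zero_neq_one)
  then show ?thesis by (rule that[OF \<phi>(1)])
qed

text \<open>
  Dickson's lemma. On a sequence that already ascends in the components from \<open>S\<close>, an index at which
  component \<open>s\<close> attains its minimum is good together with its successor.
\<close>

lemma almost_full_componentwise:
  assumes "finite S"
  shows "almost_full (\<lambda>u v :: 'b \<Rightarrow> nat. \<forall>i\<in>S. u i \<le> v i)"
  using assms
proof (induction S)
  case empty
  then show ?case by (auto simp: almost_full_def)
next
  case (insert s S)
  show ?case
    unfolding almost_full_def
  proof
    fix f :: "nat \<Rightarrow> 'b \<Rightarrow> nat"
    obtain \<phi> :: "nat \<Rightarrow> nat" where
      \<phi>: "strict_mono \<phi>" "\<And>i j. i < j \<Longrightarrow> \<forall>x\<in>S. f (\<phi> i) x \<le> f (\<phi> j) x"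
      using almost_full_subseq[OF insert.IH, of f] by blast
    obtain n where "\<forall>k. f (\<phi> n) s \<le> f (\<phi> k) s"
      using ex_has_least_nat[of "\<lambda>_. True" 0 "\<lambda>k. f (\<phi> k) s"] by auto
    then show "\<exists>i j. i < j \<and> (\<forall>x\<in>insert s S. f i x \<le> f j x)"
      using \<phi>(2)[of n "Suc n"] strict_monoD[OF \<phi>(1), of n "Suc n"] by auto
  qed
qed

text \<open>
  Higman's lemma, by the minimal bad sequence argument of Nash-Williams. In a bad sequence \<open>g\<close> whose
  words are successively chosen as short as possible, pass to a subsequence \<open>\<phi>\<close> along which the first
  letters ascend, drop these letters, and put the words before \<open>\<phi> 0\<close> in front. The
  result is again bad, because an embedding in it would give one in \<open>g\<close>, but its word at
  position \<open>\<phi> 0\<close> is shorter.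
\<close>

theorem almost_full_list_emb:
  assumes "almost_full P"
  shows "almost_full (list_emb P)"
proof (rule ccontr)
  define bad where "bad f \<longleftrightarrow> (\<forall>i j. i < j \<longrightarrow> \<not> list_emb P (f i) (f j))"
    for f :: "nat \<Rightarrow> 'a list"
  assume "\<not> almost_full (list_emb P)"
  then obtain f\<^sub>0 where f\<^sub>0: "bad f\<^sub>0" by (auto simp: almost_full_def bad_def)
  define minimal where "minimal g n r \<longleftrightarrow> (\<exists>f. bad f \<and> (\<forall>i<n. f i = g i) \<and> f n = r) \<and>
      (\<forall>f. bad f \<and> (\<forall>i<n. f i = g i) \<longrightarrow> length r \<le> length (f n))"
    for g :: "nat \<Rightarrow> 'a list" and n r
  have "\<exists>g. \<forall>n. minimal g n (g n)"
  proof (rule dependent_wellorder_choice)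
    fix r :: "'a list" and f g :: "nat \<Rightarrow> 'a list" and n :: nat
    assume "\<And>i. i < n \<Longrightarrow> f i = g i"
    then show "minimal f n r = minimal g n r" by (simp add: minimal_def)
  next
    fix n :: nat and g :: "nat \<Rightarrow> 'a list"
    assume prev: "\<And>i. i < n \<Longrightarrow> minimal g i (g i)"
    have "\<exists>f. bad f \<and> (\<forall>i<n. f i = g i)"
    proof (cases n)
      case (Suc k)
      then show ?thesis using prev[of k] by (auto simp: minimal_def less_Suc_eq)
    qed (use f\<^sub>0 in auto)
    then obtain f where "bad f \<and> (\<forall>i<n. f i = g i)" by blast
    from ex_has_least_nat[of "\<lambda>f. bad f \<and> (\<forall>i<n. f i = g i)", OF this, of "\<lambda>f. length (f n)"]
    show "\<exists>r. minimal g n r" unfolding minimal_def by blast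
  qed
  then obtain g where g: "\<And>n. minimal g n (g n)" by blast
  have "bad g"
    unfolding bad_def
  proof (intro allI impI)
    fix i j :: nat assume "i < j"
    moreover obtain f where "bad f" "\<forall>i<j. f i = g i" "f j = g j"
      using g[of j] by (auto simp: minimal_def)
    ultimately show "\<not> list_emb P (g i) (g j)" unfolding bad_def by metis
  qed
  have nonempty: "g i \<noteq> []" for i
    using \<open>bad g\<close> unfolding bad_def by (metis lessI list_emb_Nil)
  then have g_eq: "g i = hd (g i) # tl (g i)" for i by simp
  obtain \<phi> :: "nat \<Rightarrow> nat" where
    \<phi>: "strict_mono \<phi>" "\<And>i j. i < j \<Longrightarrow> P (hd (g (\<phi> i))) (hd (g (\<phi> j)))"
    using almost_full_subseq[OF assms, of "\<lambda>i. hd (g i)"] by blast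
  define h where "h i = (if i < \<phi> 0 then g i else tl (g (\<phi> (i - \<phi> 0))))" for i
  have "bad h"
    unfolding bad_def
  proof (intro allI impI notI)
    fix i j assume ij: "i < j" and emb: "list_emb P (h i) (h j)"
    consider "j < \<phi> 0" | "i < \<phi> 0" "\<phi> 0 \<le> j" | "\<phi> 0 \<le> i" by linarith
    then show False
    proof cases
      case 1
      with ij emb \<open>bad g\<close> show False by (auto simp: h_def bad_def)
    next
      case 2
      then have "list_emb P (g i) (g (\<phi> (j - \<phi> 0)))"
        using emb by (subst g_eq[of "\<phi> (j - \<phi> 0)"]) (auto simp: h_def)
      moreover have "i < \<phi> (j - \<phi> 0)"
        using 2 strict_mono_mono[OF \<phi>(1), THEN monoD, of 0 "j - \<phi> 0"] by simp
      ultimately show False using \<open>bad g\<close> by (auto simp: bad_def)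
    next
      case 3
      then have "i - \<phi> 0 < j - \<phi> 0" using ij by simp
      then have "\<phi> (i - \<phi> 0) < \<phi> (j - \<phi> 0)"
        and "P (hd (g (\<phi> (i - \<phi> 0)))) (hd (g (\<phi> (j - \<phi> 0))))"
        using \<phi> by (auto simp: strict_mono_less)
      moreover from this have "list_emb P (g (\<phi> (i - \<phi> 0))) (g (\<phi> (j - \<phi> 0)))"
        using 3 ij emb
        by (subst g_eq[of "\<phi> (j - \<phi> 0)"], subst g_eq[of "\<phi> (i - \<phi> 0)"]) (auto simp: h_def)
      ultimately show False using \<open>bad g\<close> by (auto simp: bad_def)
    qed
  qed
  moreover have "\<forall>i<\<phi> 0. h i = g i" by (simp add: h_def)
  ultimately have "length (g (\<phi> 0)) \<le> length (h (\<phi> 0))"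
    using g[of "\<phi> 0"] unfolding minimal_def by blast
  then show False
    using nonempty[of "\<phi> 0"] by (cases "g (\<phi> 0)") (simp_all add: h_def)
qed

text \<open>
  The positions hit by an embedding, with \<open>f\<close> defined and strictly increasing beyond the word \<open>xs\<close>
  as well, so that it yields an element of \<open>Inc(\<nat>)\<close>.
\<close>

lemma list_emb_strict_mono:
  assumes "list_emb P xs ys"
  shows "\<exists>f. strict_mono f \<and> (\<forall>i<length xs. f i < length ys \<and> P (xs ! i) (ys ! f i))"
  using assms
proof induction
  case (list_emb_Nil ys)
  show ?case by (intro exI[of _ id]) (simp add: strict_mono_def)
next
  case (list_emb_Cons xs ys y)
  then obtain f where "strict_mono f" "\<forall>i<length xs. f i < length ys \<and> P (xs ! i) (ys ! f i)"
    by blast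
  then show ?case
    by (intro exI[of _ "\<lambda>i. Suc (f i)"]) (simp add: strict_mono_Suc_iff)
next
  case (list_emb_Cons2 x y xs ys)
  then obtain f where f: "strict_mono f" "\<forall>i<length xs. f i < length ys \<and> P (xs ! i) (ys ! f i)"
    by blast
  define g where "g = case_nat 0 (\<lambda>i. Suc (f i))"
  have "strict_mono g"
    using f(1) by (simp add: g_def strict_mono_Suc_iff split: nat.split)
  moreover have "g i < length (y # ys) \<and> P ((x # xs) ! i) ((y # ys) ! g i)"
    if "i < length (x # xs)" for i
    using that f(2) list_emb_Cons2.hyps(1) by (cases i) (simp_all add: g_def)
  ultimately show ?case by blast
qed

section \<open>Divisibility of monomials up to increasing maps\<close>

type_synonym monomial = "(nat \<times> nat) \<Rightarrow>\<^sub>0 nat"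

abbreviation shift :: "(nat \<Rightarrow> nat) \<Rightarrow> monomial \<Rightarrow> monomial" where
  "shift \<pi> \<equiv> relabel (\<lambda>(i, j). (i, \<pi> j))"

definition monomials_X :: "nat \<Rightarrow> monomial set" where
  "monomials_X c = {m. Poly_Mapping.keys m \<subseteq> {1..c} \<times> {1..}}"

lemma carrier_poly_ring_X: "carrier (poly_ring_X c) = {p. Poly_Mapping.keys p \<subseteq> monomials_X c}"
  by (auto simp: poly_ring_X_def monomials_X_def)

definition Inc_dvd :: "nat \<Rightarrow> monomial \<Rightarrow> monomial \<Rightarrow> bool" where
  "Inc_dvd c m n \<longleftrightarrow> (\<exists>\<pi>\<in>Inc_N. \<exists>u\<in>monomials_X c. n = u + shift \<pi> m)"

lemma Inc_N_strict_mono: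
  assumes "\<pi> \<in> Inc_N"
  shows "strict_mono \<pi>"
  unfolding strict_mono_Suc_iff
proof
  fix n
  show "\<pi> n < \<pi> (Suc n)"
    using assms by (cases n) (auto simp: Inc_N_def Suc_le_eq)
qed

lemma lookup_relabel_inj:
  assumes "inj f"
  shows "Poly_Mapping.lookup (relabel f p) (f k) = Poly_Mapping.lookup p k"
proof -
  have "Poly_Mapping.lookup (relabel f p) (f k)
      = (\<Sum>l\<in>Poly_Mapping.keys p. if l = k then Poly_Mapping.lookup p l else 0)"
    using assms
    by (auto simp: relabel_def lookup_sum lookup_single when_def inj_eq intro!: sum.cong)
  then show ?thesis by (simp add: sum.delta in_keys_iff)
qed

lemma monomial_le_imp_add:
  fixes m n :: "'a \<Rightarrow>\<^sub>0 nat"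
  assumes "\<And>k. Poly_Mapping.lookup m k \<le> Poly_Mapping.lookup n k"
  obtains u where "n = u + m" "Poly_Mapping.keys u \<subseteq> Poly_Mapping.keys n"
proof
  show *: "n = (n - m) + m"
    using assms by (intro poly_mapping_eqI) (simp add: lookup_add lookup_minus)
  show "Poly_Mapping.keys (n - m) \<subseteq> Poly_Mapping.keys n"
    by (auto simp: in_keys_iff lookup_minus)
qed

text \<open>
  A monomial becomes the word of its columns \<open>1, \<dots>, width\<close>. Columns are numbered from \<open>1\<close> and
  positions in a word from \<open>0\<close>, hence the shifts by \<open>Suc\<close>.
\<close>

theorem Inc_dvd_subseq:
  fixes m :: "nat \<Rightarrow> monomial"
  assumes m: "\<And>k. m k \<in> monomials_X c"
  obtains \<phi> :: "nat \<Rightarrow> nat"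
  where "strict_mono \<phi>" "\<And>k l. k < l \<Longrightarrow> Inc_dvd c (m (\<phi> k)) (m (\<phi> l))"
proof -
  let ?P = "\<lambda>u v :: nat \<Rightarrow> nat. \<forall>i\<in>{1..c}. u i \<le> v i"
  define width where "width k = Max (insert 0 (snd ` Poly_Mapping.keys (m k)))" for k
  define word where
    "word k = map (\<lambda>j i. Poly_Mapping.lookup (m k) (i, Suc j)) [0..<width k]" for k
  have "almost_full (list_emb ?P)"
    by (intro almost_full_list_emb almost_full_componentwise) simp
  then obtain \<phi> :: "nat \<Rightarrow> nat" where
    \<phi>: "strict_mono \<phi>" "\<And>k l. k < l \<Longrightarrow> list_emb ?P (word (\<phi> k)) (word (\<phi> l))"
    using almost_full_subseq[of "list_emb ?P" word] by blast
  have "Inc_dvd c (m k) (m l)" if emb: "list_emb ?P (word k) (word l)" for k l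
  proof -
    obtain f where f: "strict_mono f"
      and f_le: "\<And>j. j < width k \<Longrightarrow> f j < width l \<and> ?P (word k ! j) (word l ! f j)"
      using list_emb_strict_mono[OF emb] by (auto simp: word_def)
    define \<pi> where "\<pi> = case_nat 0 (Suc \<circ> f)"
    have \<pi>: "\<pi> \<in> Inc_N"
      using f by (auto simp: Inc_N_def \<pi>_def strict_mono_def split: nat.split)
    then have "inj \<pi>"
      by (simp add: Inc_N_strict_mono strict_mono_imp_inj_on)
    then have inj: "inj (\<lambda>(i, j). (i :: nat, \<pi> j))"
      by (auto simp: inj_on_def)
    have "Poly_Mapping.lookup (shift \<pi> (m k)) x \<le> Poly_Mapping.lookup (m l) x" for x
    proof (cases "x \<in> Poly_Mapping.keys (shift \<pi> (m k))")
      case True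
      then obtain i j where ij: "(i, j) \<in> Poly_Mapping.keys (m k)" "x = (i, \<pi> j)"
        using keys_relabel[of "\<lambda>(i, j). (i, \<pi> j)" "m k"] by auto
      then have "i \<in> {1..c}" "j \<ge> 1" using m[of k] by (auto simp: monomials_X_def)
      then obtain j' where j': "j = Suc j'" by (cases j) auto
      have "j \<le> width k"
        unfolding width_def using ij(1) by (intro Max_ge) force+
      then have "j' < width k" using j' by simp
      then have "Poly_Mapping.lookup (m k) (i, j) \<le> Poly_Mapping.lookup (m l) x"
        using f_le[of j'] \<open>i \<in> {1..c}\<close> by (auto simp: word_def j' ij \<pi>_def)
      then show ?thesis
        using lookup_relabel_inj[OF inj, of "m k" "(i, j)"] ij by simp
    qed (simp add: in_keys_iff)
    then obtain u where "m l = u + shift \<pi> (m k)" "Poly_Mapping.keys u \<subseteq> Poly_Mapping.keys (m l)"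
      using monomial_le_imp_add by blast
    moreover from this have "u \<in> monomials_X c"
      using m[of l] by (auto simp: monomials_X_def)
    ultimately show ?thesis
      using \<pi> by (auto simp: Inc_dvd_def)
  qed
  with \<phi> that show ?thesis by blast
qed

section \<open>A monomial order compatible with increasing maps\<close>

text \<open>
  The monomial as a multiset of variables, with the column of each variable put first. In the
  lexicographic order on such pairs, the order of multisets decides by the largest variable with
  different exponents. It is well-founded and invariant under addition, and applying a strictly
  increasing map to the elements preserves it.
\<close>

definition colex :: "monomial \<Rightarrow> (nat \<times> nat) multiset" where
  "colex m = Abs_multiset (\<lambda>(j, i). Poly_Mapping.lookup m (i, j))"

lemma count_colex: "count (colex m) (j, i) = Poly_Mapping.lookup m (i, j)"
proof -
  have "{x. 0 < (case x of (j, i) \<Rightarrow> Poly_Mapping.lookup m (i, j))} = prod.swap ` Poly_Mapping.keys m"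
    by (force simp: in_keys_iff)
  then have "finite {x. 0 < (case x of (j, i) \<Rightarrow> Poly_Mapping.lookup m (i, j))}"
    by simp
  then show ?thesis
    unfolding colex_def by (subst count_Abs_multiset) auto
qed

lemma colex_eq_iff [simp]: "colex m = colex n \<longleftrightarrow> m = n"
  by (auto simp: multiset_eq_iff count_colex intro!: poly_mapping_eqI)

lemma colex_add: "colex (m + n) = colex m + colex n"
  by (auto simp: multiset_eq_iff count_colex lookup_add)

lemma colex_shift: "colex (shift \<pi> m) = image_mset (map_prod \<pi> id) (colex m)"
proof (induction m rule: update_induct)
  case const
  have "colex 0 = {#}" by (auto simp: multiset_eq_iff count_colex)
  then show ?case by simp
next
  case (update m x n)
  have single: "colex (Poly_Mapping.single (i, j) n) = replicate_mset n (j, i)" for i j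
    by (auto simp: multiset_eq_iff count_colex lookup_single when_def)
  have "Poly_Mapping.update x n m = m + Poly_Mapping.single x n"
    using update(1) by (rule update_conv_add)
  then show ?case
    using update by (cases x) (simp add: relabel_add colex_add single)
qed

lemma colex_mult_shift_less:
  assumes "strict_mono \<pi>" "colex k < colex l"
  shows "colex (u + shift \<pi> k) < colex (u + shift \<pi> l)"
  using assms
  by (auto simp: colex_add colex_shift strict_mono_def le_less intro!: image_mset_strict_mono)

definition lead :: "'k::zero xpoly \<Rightarrow> monomial" where
  "lead p = (SOME m. m \<in> Poly_Mapping.keys p \<and> (\<forall>k\<in>Poly_Mapping.keys p. colex k \<le> colex m))"

lemma
  assumes "p \<noteq> 0"
  shows lead_in_keys: "lead p \<in> Poly_Mapping.keys p"
    and colex_le_lead: "\<And>k. k \<in> Poly_Mapping.keys p \<Longrightarrow> colex k \<le> colex (lead p)"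
proof -
  have "\<exists>m\<in>Poly_Mapping.keys p. \<forall>k\<in>Poly_Mapping.keys p. colex k \<le> colex m"
  proof -
    have "Max (colex ` Poly_Mapping.keys p) \<in> colex ` Poly_Mapping.keys p"
      using assms by (intro Max_in) auto
    then obtain m where m: "m \<in> Poly_Mapping.keys p" "colex m = Max (colex ` Poly_Mapping.keys p)"
      by force
    then have "\<forall>k\<in>Poly_Mapping.keys p. colex k \<le> colex m"
      by (simp add: Max_ge)
    with m(1) show ?thesis by blast
  qed
  then have "lead p \<in> Poly_Mapping.keys p \<and> (\<forall>k\<in>Poly_Mapping.keys p. colex k \<le> colex (lead p))"
    unfolding lead_def Bex_def by (rule someI_ex)
  then show "lead p \<in> Poly_Mapping.keys p"
    "\<And>k. k \<in> Poly_Mapping.keys p \<Longrightarrow> colex k \<le> colex (lead p)"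
    by auto
qed

lemma lookup_gt_lead:
  assumes "colex (lead p) < colex k"
  shows "Poly_Mapping.lookup p k = 0"
  using colex_le_lead[of p k] assms by (cases "p = 0") (auto simp: in_keys_iff not_less[symmetric])

abbreviation lead_coeff_X :: "'k::zero xpoly \<Rightarrow> 'k" where
  "lead_coeff_X p \<equiv> Poly_Mapping.lookup p (lead p)"

text \<open>
  The map \<open>k \<mapsto> u + shift \<pi> k\<close> on monomials is strictly increasing, so it carries the leading
  monomial of \<open>p\<close> to the top of the multiple. This is stated through coefficients, because the new
  top coefficient may vanish when \<open>K\<close> has zero divisors.
\<close>

lemma
  fixes p :: "'k::{comm_ring, comm_monoid_mult} xpoly" and u :: monomial and a :: 'k
  assumes \<pi>: "\<pi> \<in> Inc_N"
  defines "q \<equiv> Poly_Mapping.single u a * act_X \<pi> p"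
  shows lookup_multiple_lead: "Poly_Mapping.lookup q (u + shift \<pi> (lead p)) = a * lead_coeff_X p"
    and lookup_multiple_above: "colex (u + shift \<pi> (lead p)) < colex k \<Longrightarrow> Poly_Mapping.lookup q k = 0"
proof -
  note mono = Inc_N_strict_mono[OF \<pi>]
  have q: "q = (\<Sum>k\<in>Poly_Mapping.keys p.
      Poly_Mapping.single (u + shift \<pi> k) (a * Poly_Mapping.lookup p k))"
    by (simp add: q_def act_X_def relabel_def[of "shift \<pi>"] sum_distrib_left mult_single)
  have inj: "shift \<pi> k = shift \<pi> l \<longleftrightarrow> k = l" for k l
    using colex_mult_shift_less[OF mono, of k l 0] colex_mult_shift_less[OF mono, of l k 0]
    by (cases "colex k" "colex l" rule: linorder_cases) auto
  have "Poly_Mapping.lookup q (u + shift \<pi> (lead p))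
      = (\<Sum>k\<in>Poly_Mapping.keys p. if k = lead p then a * Poly_Mapping.lookup p k else 0)"
    unfolding q lookup_sum by (intro sum.cong) (auto simp: lookup_single when_def inj)
  also have "\<dots> = a * lead_coeff_X p"
    by (simp add: in_keys_iff)
  finally show "Poly_Mapping.lookup q (u + shift \<pi> (lead p)) = a * lead_coeff_X p" .
  assume above: "colex (u + shift \<pi> (lead p)) < colex k"
  have "u + shift \<pi> l \<noteq> k" if "l \<in> Poly_Mapping.keys p" for l
  proof -
    have "p \<noteq> 0" using that by auto
    then have "colex l < colex (lead p) \<or> l = lead p"
      using colex_le_lead[OF _ that] by (auto simp: le_less)
    then show ?thesis
      using above colex_mult_shift_less[OF mono, of l "lead p" u] by auto
  qed
  then show "Poly_Mapping.lookup q k = 0"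
    unfolding q lookup_sum by (intro sum.neutral) (auto simp: lookup_single when_def)
qed

text \<open>
  Reduction by several polynomials at once: over a ring that is not a field, the leading
  coefficient of \<open>f\<close> need not be a multiple of any single one of theirs.
\<close>

lemma reduction_lowers_lead:
  fixes f :: "'k::{comm_ring, comm_monoid_mult} xpoly"
  assumes \<pi>: "\<And>i. i < n \<Longrightarrow> \<pi> i \<in> Inc_N"
    and lead: "\<And>i. i < n \<Longrightarrow> lead f = u i + shift (\<pi> i) (lead (g i))"
    and coeff: "lead_coeff_X f = (\<Sum>i<n. r i * lead_coeff_X (g i))"
  defines "h \<equiv> f - (\<Sum>i<n. Poly_Mapping.single (u i) (r i) * act_X (\<pi> i) (g i))"
  assumes "h \<noteq> 0"
  shows "colex (lead h) < colex (lead f)"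
proof -
  have h: "Poly_Mapping.lookup h k = Poly_Mapping.lookup f k
      - (\<Sum>i<n. Poly_Mapping.lookup (Poly_Mapping.single (u i) (r i) * act_X (\<pi> i) (g i)) k)" for k
    by (simp add: h_def lookup_minus lookup_sum)
  have "Poly_Mapping.lookup (Poly_Mapping.single (u i) (r i) * act_X (\<pi> i) (g i)) (lead f)
      = r i * lead_coeff_X (g i)" if "i < n" for i
    using lookup_multiple_lead[OF \<pi>[OF that], of "u i" "r i" "g i"] lead[OF that] by simp
  then have "Poly_Mapping.lookup h (lead f) = 0"
    by (simp add: h coeff)
  moreover have "Poly_Mapping.lookup h k = 0" if "colex (lead f) < colex k" for k
  proof -
    have "Poly_Mapping.lookup (Poly_Mapping.single (u i) (r i) * act_X (\<pi> i) (g i)) k = 0"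
      if "i < n" for i
      using lookup_multiple_above[OF \<pi>[OF that]] lead[OF that] \<open>colex (lead f) < colex k\<close> by simp
    then show ?thesis using lookup_gt_lead[OF that] by (simp add: h)
  qed
  moreover have "Poly_Mapping.lookup h (lead h) \<noteq> 0"
    using lead_in_keys[OF \<open>h \<noteq> 0\<close>] by (simp add: in_keys_iff)
  ultimately show ?thesis
    by (metis colex_eq_iff linorder_less_linear)
qed

section \<open>Finite generation\<close>

text \<open>
  The ideals generated by \<open>a 0, \<dots>, a (n - 1)\<close> form an ascending chain, which becomes stationary.
\<close>

lemma noetherian_coeff_relation:
  fixes a :: "nat \<Rightarrow> 'k::{comm_ring, comm_monoid_mult}"
  assumes "noetherian_ring (coeff_ring :: 'k ring)"
  shows "\<exists>n r. a n = (\<Sum>i<n. r i * a i)"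
proof -
  let ?K = "coeff_ring :: 'k ring"
  interpret noetherian_ring ?K by fact
  define L where "L n = {\<Sum>i<n. r i * a i | r. True}" for n
  have "ideal (L n) ?K" for n
  proof (rule idealI)
    show "ring ?K" by (rule ring_axioms)
    show "subgroup (L n) (add_monoid ?K)"
    proof (rule group.subgroupI)
      show "group (add_monoid ?K)" using add.is_group .
      show "L n \<subseteq> carrier (add_monoid ?K)" by (simp add: coeff_ring_def)
      show "L n \<noteq> {}" by (auto simp: L_def)
    next
      fix x assume "x \<in> L n"
      then obtain r where "x = (\<Sum>i<n. r i * a i)" by (auto simp: L_def)
      moreover have "\<ominus>\<^bsub>?K\<^esub> x = - x"
        by (rule minus_equality) (auto simp: coeff_ring_def)
      ultimately have "\<ominus>\<^bsub>?K\<^esub> x = (\<Sum>i<n. (- r i) * a i)" by (simp add: sum_negf)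
      then have "\<ominus>\<^bsub>?K\<^esub> x \<in> L n" unfolding L_def
        by (intro CollectI exI[of _ "\<lambda>i. - r i"] conjI TrueI)
      then show "inv\<^bsub>add_monoid ?K\<^esub> x \<in> L n" unfolding a_inv_def .
    next
      fix x y assume "x \<in> L n" "y \<in> L n"
      then obtain r s where "x = (\<Sum>i<n. r i * a i)" "y = (\<Sum>i<n. s i * a i)"
        by (auto simp: L_def)
      then have "x + y = (\<Sum>i<n. (r i + s i) * a i)" by (simp add: sum.distrib distrib_right)
      then show "x \<otimes>\<^bsub>add_monoid ?K\<^esub> y \<in> L n"
        by (auto simp: L_def coeff_ring_def intro!: exI[of _ "\<lambda>i. r i + s i"])
    qed
    fix x y assume "x \<in> L n"
    then obtain r where "x = (\<Sum>i<n. r i * a i)" by (auto simp: L_def)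
    then have "y * x = (\<Sum>i<n. (y * r i) * a i)" by (simp add: sum_distrib_left mult.assoc)
    then show "y \<otimes>\<^bsub>?K\<^esub> x \<in> L n" "x \<otimes>\<^bsub>?K\<^esub> y \<in> L n"
      by (auto simp: L_def coeff_ring_def mult.commute[of x] intro!: exI[of _ "\<lambda>i. y * r i"])
  qed
  moreover have mono: "L m \<subseteq> L n" if "m \<le> n" for m n
  proof
    fix x assume "x \<in> L m"
    then obtain r where "x = (\<Sum>i<m. r i * a i)" by (auto simp: L_def)
    also have "\<dots> = (\<Sum>i<n. (if i < m then r i else 0) * a i)"
      using that by (intro sum.mono_neutral_cong_left) auto
    finally show "x \<in> L n" by (auto simp: L_def)
  qed
  have "L m \<subseteq> L n \<or> L n \<subseteq> L m" for m n
    using mono[of m n] mono[of n m] linear[of m n] by blast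
  ultimately have "subset.chain {I. ideal I ?K} (range L)"
    by (auto simp: subset_chain_def)
  from ideal_chain_is_trivial[OF _ this] obtain n where n: "(\<Union>(range L)) = L n" by auto
  have "a n = (\<Sum>i<Suc n. (if i = n then 1 else 0) * a i)"
    by (simp add: if_distrib[of "\<lambda>x. x * _"] cong: if_cong)
  then have "a n \<in> L (Suc n)"
    unfolding L_def by (intro CollectI exI[of _ "\<lambda>i. if i = n then 1 else 0"] conjI TrueI)
  with n have "a n \<in> L n" by blast
  then show ?thesis by (auto simp: L_def)
qed

context
  fixes c :: nat and J :: "'k::{comm_ring, comm_monoid_mult} xpoly set"
  assumes J: "ideal J (poly_ring_X c)"
begin

lemma ideal_X_zero: "0 \<in> J"
  using additive_subgroup.zero_closed[OF ideal.axioms(1)[OF J]] by (simp add: poly_ring_X_def)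

lemma ideal_X_add: "p \<in> J \<Longrightarrow> q \<in> J \<Longrightarrow> p + q \<in> J"
  using additive_subgroup.a_closed[OF ideal.axioms(1)[OF J]] by (simp add: poly_ring_X_def)

lemma ideal_X_mult: "p \<in> carrier (poly_ring_X c) \<Longrightarrow> q \<in> J \<Longrightarrow> p * q \<in> J"
  using ideal.I_l_closed[OF J, of q p] by (simp add: poly_ring_X_def)

lemma ideal_X_diff:
  assumes "p \<in> J" "q \<in> J"
  shows "p - q \<in> J"
proof -
  interpret cring "poly_ring_X c :: 'k xpoly ring" by (rule cring_poly_ring_X)
  have q: "q \<in> carrier (poly_ring_X c)"
    using additive_subgroup.a_Hcarr[OF ideal.axioms(1)[OF J] assms(2)] .
  then have "\<ominus>\<^bsub>poly_ring_X c\<^esub> q = - q"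
    by (intro minus_equality) (auto simp: poly_ring_X_def)
  then have "- q \<in> J"
    using additive_subgroup.a_inv_closed[OF ideal.axioms(1)[OF J] assms(2)] by simp
  then show ?thesis
    using ideal_X_add[OF assms(1), of "- q"] by simp
qed

lemma ideal_X_sum: "(\<And>i. i \<in> A \<Longrightarrow> p i \<in> J) \<Longrightarrow> (\<Sum>i\<in>A. p i) \<in> J"
  by (induction A rule: infinite_finite_induct) (auto intro: ideal_X_zero ideal_X_add)

end

lemma orbit_of_subset_carrier:
  assumes "G \<subseteq> Inc_N \<union> Sym_inf" "f \<in> carrier (poly_ring_X c)"
  shows "orbit_of act_X G f \<subseteq> carrier (poly_ring_X c)"
  using ring_hom_closed[OF act_X_endomorphism] assms unfolding orbit_of_def by blast

theorem Inc_N_noetherian_poly_ring_X: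
  assumes K: "noetherian_ring (coeff_ring :: 'k::{comm_ring, comm_monoid_mult} ring)"
  shows "equivariantly_noetherian act_X Inc_N (poly_ring_X c :: 'k xpoly ring)"
  unfolding equivariantly_noetherian_def
proof (intro allI impI, rule ccontr)
  let ?R = "poly_ring_X c :: 'k xpoly ring"
  interpret R: cring ?R by (rule cring_poly_ring_X)
  fix I assume I: "invariant_ideal act_X Inc_N ?R I"
  define J where "J F = genideal ?R (\<Union>f\<in>F. orbit_of act_X Inc_N f)" for F
  assume "\<not> (\<exists>F\<subseteq>carrier ?R. finite F \<and> I = genideal ?R (\<Union>f\<in>F. orbit_of act_X Inc_N f))"
  then have no_basis: "I \<noteq> J F" if "F \<subseteq> carrier ?R" "finite F" for F
    using that by (auto simp: J_def)
  have I_ideal: "ideal I ?R" and I_act: "\<And>\<pi> f. \<pi> \<in> Inc_N \<Longrightarrow> f \<in> I \<Longrightarrow> act_X \<pi> f \<in> I"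
    using I by (auto simp: invariant_ideal_def)
  have I_carrier: "I \<subseteq> carrier ?R"
    using I_ideal by (intro additive_subgroup.a_subset) (rule ideal.axioms(1))
  have orbits: "(\<Union>f\<in>F. orbit_of act_X Inc_N f) \<subseteq> carrier ?R" if "F \<subseteq> I" for F
    using orbit_of_subset_carrier[of Inc_N _ c] that I_carrier by blast
  have J_ideal: "ideal (J F) ?R" if "F \<subseteq> I" for F
    unfolding J_def by (intro R.genideal_ideal orbits that)
  have J_sub: "J F \<subseteq> I" if "F \<subseteq> I" for F
    unfolding J_def
    by (rule R.genideal_minimal[OF I_ideal]) (use I_act that in \<open>auto simp: orbit_of_def\<close>)
  have J_orbit: "act_X \<pi> f \<in> J F" if "F \<subseteq> I" "f \<in> F" "\<pi> \<in> Inc_N" for F f \<pi>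
    using R.genideal_self[OF orbits[OF that(1)]] that(2,3) by (auto simp: J_def orbit_of_def)

  \<comment> \<open>The element chosen after \<open>F\<close>: not yet generated, and of least leading monomial.\<close>
  define minimal where "minimal F p \<longleftrightarrow> p \<in> I - J F \<and>
      (\<forall>q\<in>I - J F. colex (lead p) \<le> colex (lead q))" for F p
  have "\<exists>f. \<forall>n :: nat. minimal (f ` {..<n}) (f n)"
  proof (rule dependent_wellorder_choice)
    fix r :: "'k xpoly" and f g :: "nat \<Rightarrow> 'k xpoly" and n :: nat
    assume "\<And>i. i < n \<Longrightarrow> f i = g i"
    then have "f ` {..<n} = g ` {..<n}" by auto
    then show "minimal (f ` {..<n}) r = minimal (g ` {..<n}) r" by simp
  next
    fix n :: nat and f :: "nat \<Rightarrow> 'k xpoly"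
    assume "\<And>i. i < n \<Longrightarrow> minimal (f ` {..<i}) (f i)"
    then have F: "f ` {..<n} \<subseteq> I" by (auto simp: minimal_def)
    let ?D = "I - J (f ` {..<n})"
    have "?D \<noteq> {}"
      using no_basis[of "f ` {..<n}"] J_sub[OF F] F I_carrier by auto
    then obtain q where "q \<in> ?D" by blast
    then have "(LEAST x. x \<in> (\<lambda>q. colex (lead q)) ` ?D) \<in> (\<lambda>q. colex (lead q)) ` ?D"
      by (intro LeastI) auto
    then obtain p where p: "p \<in> ?D" "colex (lead p) = (LEAST x. x \<in> (\<lambda>q. colex (lead q)) ` ?D)"
      by force
    then have "colex (lead p) \<le> colex (lead q)" if "q \<in> ?D" for q
      using that by (auto intro: Least_le)
    then show "\<exists>r. minimal (f ` {..<n}) r"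
      using p(1) unfolding minimal_def by blast
  qed
  then obtain f :: "nat \<Rightarrow> 'k xpoly" where f: "\<And>n. minimal (f ` {..<n}) (f n)" by blast
  have f_I: "f n \<in> I" for n using f[of n] by (simp add: minimal_def)
  then have F: "f ` A \<subseteq> I" for A by blast
  have "f n \<noteq> 0" for n
    using f[of n] ideal_X_zero[OF J_ideal[OF F]] unfolding minimal_def by (metis Diff_iff)
  then have lead_X: "lead (f n) \<in> monomials_X c" for n
    using lead_in_keys[of "f n"] f_I[of n] I_carrier by (auto simp: carrier_poly_ring_X)

  obtain \<phi> :: "nat \<Rightarrow> nat" where \<phi>: "strict_mono \<phi>"
    and dvd: "\<And>i j. i < j \<Longrightarrow> Inc_dvd c (lead (f (\<phi> i))) (lead (f (\<phi> j)))"
    by (rule Inc_dvd_subseq[of "\<lambda>n. lead (f n)", OF lead_X]) (rule that)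
  obtain n r where coeff: "lead_coeff_X (f (\<phi> n)) = (\<Sum>i<n. r i * lead_coeff_X (f (\<phi> i)))"
    using noetherian_coeff_relation[OF K, of "\<lambda>i. lead_coeff_X (f (\<phi> i))"] by blast
  have "\<forall>i\<in>{..<n}. \<exists>\<pi> u. \<pi> \<in> Inc_N \<and> u \<in> monomials_X c \<and>
      lead (f (\<phi> n)) = u + shift \<pi> (lead (f (\<phi> i)))"
    using dvd[of _ n] unfolding Inc_dvd_def by (metis lessThan_iff)
  then obtain \<pi> u where \<pi>: "\<And>i. i < n \<Longrightarrow> \<pi> i \<in> Inc_N"
    and u: "\<And>i. i < n \<Longrightarrow> u i \<in> monomials_X c"
    and lead: "\<And>i. i < n \<Longrightarrow> lead (f (\<phi> n)) = u i + shift (\<pi> i) (lead (f (\<phi> i)))"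
    by (metis lessThan_iff)
  \<comment> \<open>Subtracting \<open>s\<close> cancels the leading term, and \<open>\<phi> i < \<phi> n\<close> puts \<open>s\<close> into the ideal already generated.\<close>
  define s where "s = (\<Sum>i<n. Poly_Mapping.single (u i) (r i) * act_X (\<pi> i) (f (\<phi> i)))"
  let ?F = "f ` {..<\<phi> n}"
  have s: "s \<in> J ?F"
    unfolding s_def
  proof (intro ideal_X_sum[OF J_ideal[OF F]] ideal_X_mult[OF J_ideal[OF F]] J_orbit F)
    fix i assume "i \<in> {..<n}"
    then show "Poly_Mapping.single (u i) (r i) \<in> carrier ?R" "\<pi> i \<in> Inc_N" "f (\<phi> i) \<in> ?F"
      using u \<pi> strict_monoD[OF \<phi>, of i n] by (auto simp: carrier_poly_ring_X)
  qed
  have not_J: "f (\<phi> n) - s \<notin> J ?F"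
    using ideal_X_add[OF J_ideal[OF F] _ s, of "f (\<phi> n) - s"] f[of "\<phi> n"] by (auto simp: minimal_def)
  then have "f (\<phi> n) - s \<noteq> 0"
    using ideal_X_zero[OF J_ideal[OF F]] by metis
  then have "colex (lead (f (\<phi> n) - s)) < colex (lead (f (\<phi> n)))"
    using reduction_lowers_lead[where f = "f (\<phi> n)" and g = "f \<circ> \<phi>" and \<pi> = \<pi> and u = u, of n r]
      \<pi> lead coeff by (simp add: s_def)
  moreover have "f (\<phi> n) - s \<in> I - J ?F"
    using ideal_X_diff[OF I_ideal f_I] s J_sub[OF F] not_J by blast
  then have "colex (lead (f (\<phi> n))) \<le> colex (lead (f (\<phi> n) - s))"
    using f[of "\<phi> n"] unfolding minimal_def by blast
  ultimately show False by simp
qed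

section \<open>From increasing maps to permutations\<close>

lemma relabel_id: "relabel id = id"
proof
  fix p :: "'a \<Rightarrow>\<^sub>0 'b::comm_monoid_add"
  show "relabel id p = id p"
    using lookup_relabel_inj[of id p] by (intro poly_mapping_eqI) simp
qed

lemma relabel_cong:
  assumes "\<And>k. k \<in> Poly_Mapping.keys p \<Longrightarrow> f k = g k"
  shows "relabel f p = relabel g p"
  using assms by (simp add: relabel_def)

lemma act_X_cong:
  assumes "\<And>m i j. m \<in> Poly_Mapping.keys p \<Longrightarrow> (i, j) \<in> Poly_Mapping.keys m \<Longrightarrow> \<pi> j = \<sigma> j"
  shows "act_X \<pi> p = act_X \<sigma> p"
  unfolding act_X_def by (intro relabel_cong) (use assms in auto)

text \<open>
  The injection \<open>[n] \<rightarrow> [N]\<close> given by \<open>\<pi>\<close> extends to a permutation of \<open>[N]\<close>, since the complements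
  of \<open>[n]\<close> and of its image have the same size. Taking \<open>N = \<pi> (n + 1)\<close> makes \<open>N\<close> positive even for
  \<open>n = 0\<close> and at least as large as \<open>n\<close> and its image.
\<close>

lemma Inc_N_agrees_Sym_inf:
  assumes "\<pi> \<in> Inc_N"
  obtains \<sigma> where "\<sigma> \<in> Sym_inf" "\<And>j. j \<le> n \<Longrightarrow> \<sigma> j = \<pi> j"
proof -
  note mono = Inc_N_strict_mono[OF assms]
  define N where "N = \<pi> (Suc n)"
  have pos: "\<pi> j \<ge> 1" if "j \<ge> 1" for j using assms that by (simp add: Inc_N_def)
  have N: "Suc n \<le> N" "1 \<le> N"
    using strict_mono_imp_increasing[OF mono, of "Suc n"] pos by (auto simp: N_def)
  have img: "\<pi> ` {1..n} \<subseteq> {1..N}"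
    using pos strict_mono_less_eq[OF mono] by (auto simp: N_def)
  have inj: "inj_on \<pi> {1..n}"
    using mono strict_mono_imp_inj_on inj_on_subset by blast
  have "card (\<pi> ` {1..n}) = n"
    using card_image[OF inj] by simp
  then have "card ({1..N} - {1..n}) = card ({1..N} - \<pi> ` {1..n})"
    using N img by (simp add: card_Diff_subset)
  then obtain h where h: "bij_betw h ({1..N} - {1..n}) ({1..N} - \<pi> ` {1..n})"
    by (metis finite_Diff finite_atLeastAtMost finite_same_card_bij)
  define \<sigma> where "\<sigma> j = (if j \<in> {1..n} then \<pi> j else if j \<in> {1..N} then h j else j)" for j
  have "bij_betw \<sigma> ({1..n} \<union> ({1..N} - {1..n})) (\<pi> ` {1..n} \<union> ({1..N} - \<pi> ` {1..n}))"
  proof (rule bij_betw_combine)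
    show "bij_betw \<sigma> {1..n} (\<pi> ` {1..n})"
      using inj by (subst bij_betw_cong[of _ _ \<pi>]) (auto simp: \<sigma>_def bij_betw_def)
    show "bij_betw \<sigma> ({1..N} - {1..n}) ({1..N} - \<pi> ` {1..n})"
      using h by (subst bij_betw_cong[of _ _ h]) (auto simp: \<sigma>_def)
  qed auto
  moreover have "{1..n} \<union> ({1..N} - {1..n}) = {1..N}" "\<pi> ` {1..n} \<union> ({1..N} - \<pi> ` {1..n}) = {1..N}"
    using N img by auto
  ultimately have "\<sigma> permutes {1..N}"
    using N by (intro bij_imp_permutes) (auto simp: \<sigma>_def)
  then have "\<sigma> \<in> Sym_inf" using N by (auto simp: Sym_inf_def)
  moreover have "\<sigma> j = \<pi> j" if "j \<le> n" for j
    using that N assms by (cases j) (auto simp: \<sigma>_def Inc_N_def)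
  ultimately show ?thesis by (rule that)
qed

text \<open>
  A polynomial involves only finitely many columns, and the action depends on \<open>\<pi>\<close> only through its
  values there.
\<close>

lemma act_X_Inc_N_in_orbit_Sym_inf:
  assumes "\<pi> \<in> Inc_N"
  shows "act_X \<pi> p \<in> orbit_of act_X Sym_inf p"
proof -
  define cols where "cols = (\<Union>m\<in>Poly_Mapping.keys p. snd ` Poly_Mapping.keys m)"
  have "finite cols" by (simp add: cols_def)
  obtain \<sigma> where \<sigma>: "\<sigma> \<in> Sym_inf" "\<And>j. j \<le> Max cols \<Longrightarrow> \<sigma> j = \<pi> j"
    using Inc_N_agrees_Sym_inf[OF assms] by blast
  have "act_X \<pi> p = act_X \<sigma> p"
  proof (rule act_X_cong)
    fix m i j assume "m \<in> Poly_Mapping.keys p" "(i, j) \<in> Poly_Mapping.keys m"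
    then have "j \<in> cols" unfolding cols_def by force
    then show "\<pi> j = \<sigma> j" using \<sigma>(2) \<open>finite cols\<close> by simp
  qed
  then show ?thesis using \<sigma>(1) by (auto simp: orbit_of_def)
qed

lemma Sym_inf_noetherian_if_Inc_N_noetherian:
  assumes "equivariantly_noetherian act_X Inc_N (poly_ring_X c :: 'k::{comm_ring, comm_monoid_mult} xpoly ring)"
  shows "equivariantly_noetherian act_X Sym_inf (poly_ring_X c :: 'k xpoly ring)"
  unfolding equivariantly_noetherian_def
proof (intro allI impI)
  let ?R = "poly_ring_X c :: 'k xpoly ring"
  interpret R: cring ?R by (rule cring_poly_ring_X)
  fix I assume I: "invariant_ideal act_X Sym_inf ?R I"
  have I_ideal: "ideal I ?R" and I_orbit: "\<And>f. f \<in> I \<Longrightarrow> orbit_of act_X Sym_inf f \<subseteq> I"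
    using I by (auto simp: invariant_ideal_def orbit_of_def)
  have "invariant_ideal act_X Inc_N ?R I"
    using I_ideal I_orbit act_X_Inc_N_in_orbit_Sym_inf by (auto simp: invariant_ideal_def)
  then obtain F where F: "F \<subseteq> carrier ?R" "finite F"
    and I_eq: "I = genideal ?R (\<Union>f\<in>F. orbit_of act_X Inc_N f)"
    using assms by (auto simp: equivariantly_noetherian_def)
  have Inc_orbits: "(\<Union>f\<in>F. orbit_of act_X Inc_N f) \<subseteq> carrier ?R"
    and Sym_orbits: "(\<Union>f\<in>F. orbit_of act_X Sym_inf f) \<subseteq> carrier ?R"
    using orbit_of_subset_carrier[of _ _ c] F(1) by blast+
  have "f \<in> orbit_of act_X Inc_N f" for f :: "'k xpoly"
  proof -
    have "act_X id f = f" by (simp add: act_X_def relabel_id)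
    moreover have "id \<in> Inc_N" by (simp add: Inc_N_def)
    ultimately show ?thesis unfolding orbit_of_def by (metis image_eqI)
  qed
  then have "F \<subseteq> (\<Union>f\<in>F. orbit_of act_X Inc_N f)" by blast
  then have "F \<subseteq> I"
    using R.genideal_self[OF Inc_orbits] I_eq by blast
  then have "genideal ?R (\<Union>f\<in>F. orbit_of act_X Sym_inf f) \<subseteq> I"
    using I_orbit by (intro R.genideal_minimal[OF I_ideal]) blast
  moreover have "(\<Union>f\<in>F. orbit_of act_X Inc_N f) \<subseteq> (\<Union>f\<in>F. orbit_of act_X Sym_inf f)"
    using act_X_Inc_N_in_orbit_Sym_inf by (auto simp: orbit_of_def[of _ Inc_N])
  then have "I \<subseteq> genideal ?R (\<Union>f\<in>F. orbit_of act_X Sym_inf f)"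
    unfolding I_eq by (rule R.subset_Idl_subset[OF Sym_orbits])
  ultimately show "\<exists>F\<subseteq>carrier ?R. finite F \<and> I = genideal ?R (\<Union>f\<in>F. orbit_of act_X Sym_inf f)"
    using F by blast
qed

theorem corollary6p21:
  fixes c :: nat
  assumes "noetherian_ring (coeff_ring :: 'k::{comm_ring, comm_monoid_mult} ring)"
    and "c \<ge> 1"
  shows "equivariantly_noetherian act_X Inc_N (poly_ring_X c :: 'k xpoly ring) \<and>
    equivariantly_noetherian act_X Sym_inf (poly_ring_X c :: 'k xpoly ring)"
  using Inc_N_noetherian_poly_ring_X[OF assms(1)] Sym_inf_noetherian_if_Inc_N_noetherian by blast

end
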